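(* For every contextuality scenario $T=(X,Y,K,\mathcal{OE}_P,\mathcal{OE}_M)$, the set of quantum behaviours $\mathcal{Q}\subset\mathbb{R}^{XYK}$ is convex.
   Context: For a positive integer $N$, $[N]=\{0,\dots,N-1\}$. A contextuality scenario is a tuple $T=(X,Y,K,\mathcal{OE}_P,\mathcal{OE}_M)$ where $X,Y,K$ are positive integers (numbers of preparations, measurements, and outcomes per measurement), $\mathcal{OE}_P=\{\{\alpha^v_j\}_{j\in[V_v]}\}_{v\in[V]}$ is a finite (possibly empty) family in which each $\{\alpha^v_j\}_{j\in[V_v]}$ consists of $V_v\ge 2$ distinct probability distributions on $[X]$, and $\mathcal{OE}_M=\{\{\beta^w_j\}_{j\in[W_w]}\}_{w\in[W]}$ is a finite (possibly empty) family in which each $\{\beta^w_j\}_{j\in[W_w]}$ consists of $W_w\ge 2$ distinct probability distributions on $[K]\times[Y]$. A behaviour is a vector $\mathbf{p}=(p(k|x,y))_{x\in[X],y\in[Y],k\in[K]}\in\mathbb{R}^{XYK}$. The set $\mathcal{Q}$ (depending on $T$) is the set of behaviours $\mathbf{p}$ for which there exist a finite-dimensional complex Hilbert space $\mathcal{H}$ (of arbitrary dimension), density operators $\rho_x$ ($x\in[X]$) on $\mathcal{H}$, and POVMs $\{M^y_k\}_{k\in[K]}$ ($y\in[Y]$) on $\mathcal{H}$ (i.e. $M^y_k\ge 0$, $\sum_k M^y_k=\mathbb{I}$), such that $p(k|x,y)=\operatorname{tr}(\rho_x M^y_k)$ for all $x,y,k$ and: (i) for every $v\in[V]$ the operator $\sum_{x}\alpha^v_j(x)\rho_x$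 is the same for all $j\in[V_v]$; (ii) for every $w\in[W]$ the operator $\sum_{k,y}\beta^w_j(k,y)M^y_k$ is the same for all $j\in[W_w]$. *)

theory Defs
  imports "HOL-Probability.Probability" "Jordan_Normal_Form.Matrix"
begin

text \<open>The index sets $[X]$, $[Y]$, $[K]$ are rendered as type variables
  \<open>'x\<close>, \<open>'y\<close>, \<open>'k\<close> of class \<open>finite\<close>, so that
  $X, Y, K \ge 1$ holds automatically. The finite indexed families are rendered as lists (of lists).\<close>

record ('x, 'y, 'k) scenario =
  OE_P :: "'x pmf list list"
  OE_M :: "('k \<times> 'y) pmf list list"

definition contextuality_scenario :: "('x::finite, 'y::finite, 'k::finite) scenario \<Rightarrow> bool" where
  "contextuality_scenario T \<longleftrightarrow>
     (\<forall>\<alpha> \<in> set (OE_P T). length \<alpha> \<ge> 2 \<and> distinct \<alpha>) \<and>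
     (\<forall>\<beta> \<in> set (OE_M T). length \<beta> \<ge> 2 \<and> distinct \<beta>)"

text \<open>Every finite-dimensional complex Hilbert space is isometric to some $\mathbb{C}^d$; its
  operators are the complex \<open>d \<times> d\<close> matrices.\<close>

abbreviation op_sum :: "nat \<Rightarrow> ('i \<Rightarrow> complex mat) \<Rightarrow> 'i set \<Rightarrow> complex mat" where
  "op_sum d A I \<equiv> finsum (module_mat TYPE(complex) d d) A I"

definition mat_trace :: "complex mat \<Rightarrow> complex" where
  "mat_trace A = (\<Sum>i<dim_row A. A $$ (i, i))"

text \<open>The order on \<open>complex\<close> is that of \<open>Complex_Order\<close>: \<open>0 \<le> z\<close> says that
  \<open>z\<close> is real and nonnegative. Over the complex numbers this forces \<open>A\<close> to be Hermitian.\<close>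

definition positive_op :: "nat \<Rightarrow> complex mat \<Rightarrow> bool" where
  "positive_op d A \<longleftrightarrow> A \<in> carrier_mat d d \<and> (\<forall>v \<in> carrier_vec d. 0 \<le> (A *\<^sub>v v) \<bullet>c v)"

definition density_op :: "nat \<Rightarrow> complex mat \<Rightarrow> bool" where
  "density_op d \<rho> \<longleftrightarrow> positive_op d \<rho> \<and> mat_trace \<rho> = 1"

definition povm :: "nat \<Rightarrow> ('k::finite \<Rightarrow> complex mat) \<Rightarrow> bool" where
  "povm d M \<longleftrightarrow> (\<forall>k. positive_op d (M k)) \<and> op_sum d M UNIV = 1\<^sub>m d"

text \<open>A behaviour \<open>p\<close> has the entry $p(k|x,y)$ at index \<open>(k, x, y)\<close>.\<close>

definition quantum_behaviours ::
    "('x::finite, 'y::finite, 'k::finite) scenario \<Rightarrow> (real ^ ('k \<times> 'x \<times> 'y)) set" where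
  "quantum_behaviours T = {p. \<exists>d (\<rho> :: 'x \<Rightarrow> complex mat) (M :: 'y \<Rightarrow> 'k \<Rightarrow> complex mat).
     (\<forall>x. density_op d (\<rho> x)) \<and>
     (\<forall>y. povm d (M y)) \<and>
     (\<forall>k x y. complex_of_real (vec_nth p (k, x, y)) = mat_trace (\<rho> x * M y k)) \<and>
     (\<forall>\<alpha> \<in> set (OE_P T). \<forall>a \<in> set \<alpha>. \<forall>a' \<in> set \<alpha>.
        op_sum d (\<lambda>x. complex_of_real (pmf a x) \<cdot>\<^sub>m \<rho> x) UNIV =
        op_sum d (\<lambda>x. complex_of_real (pmf a' x) \<cdot>\<^sub>m \<rho> x) UNIV) \<and>
     (\<forall>\<beta> \<in> set (OE_M T). \<forall>b \<in> set \<beta>. \<forall>b' \<in> set \<beta>.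
        op_sum d (\<lambda>(k, y). complex_of_real (pmf b (k, y)) \<cdot>\<^sub>m M y k) UNIV =
        op_sum d (\<lambda>(k, y). complex_of_real (pmf b' (k, y)) \<cdot>\<^sub>m M y k) UNIV)}"

end

theory Submission
  imports Defs
begin

text \<open>A convex combination \<open>s p + t q\<close> is realised on the direct sum of the two Hilbert spaces:
  the weights go into the states, \<open>\<rho> = s \<rho>\<^sub>1 \<oplus> t \<rho>\<^sub>2\<close>, while
  the measurements are \<open>M = M\<^sub>1 \<oplus> M\<^sub>2\<close>. The operational equivalences are linear
  and therefore pass to direct sums; the arbitrary dimension is what makes this possible.\<close>

text \<open>The direct sum A \<oplus> B. The sizes of the zero blocks are read off the arguments, so
  \<open>dsum_mat_smult\<close> needs no carrier assumptions.\<close>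

definition dsum_mat :: "'a::zero mat \<Rightarrow> 'a mat \<Rightarrow> 'a mat" where
  "dsum_mat A B = four_block_mat A (0\<^sub>m (dim_row A) (dim_col B)) (0\<^sub>m (dim_row B) (dim_col A)) B"

lemma dsum_mat_carrier [simp, intro]:
  "A \<in> carrier_mat n m \<Longrightarrow> B \<in> carrier_mat n' m' \<Longrightarrow> dsum_mat A B \<in> carrier_mat (n + n') (m + m')"
  unfolding dsum_mat_def by auto

lemma dsum_mat_zero: "dsum_mat (0\<^sub>m n m) (0\<^sub>m n' m') = 0\<^sub>m (n + n') (m + m')"
  unfolding dsum_mat_def by (intro eq_matI) auto

lemma dsum_mat_one: "dsum_mat (1\<^sub>m n) (1\<^sub>m m) = 1\<^sub>m (n + m)"
  unfolding dsum_mat_def by (intro eq_matI) auto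

lemma dsum_mat_add:
  fixes A B :: "'a::monoid_add mat"
  assumes "A \<in> carrier_mat n m" "A' \<in> carrier_mat n m" "B \<in> carrier_mat n' m'" "B' \<in> carrier_mat n' m'"
  shows "dsum_mat A B + dsum_mat A' B' = dsum_mat (A + A') (B + B')"
  using assms unfolding dsum_mat_def by (intro eq_matI) auto

lemma dsum_mat_smult:
  fixes A B :: "'a::mult_zero mat"
  shows "c \<cdot>\<^sub>m dsum_mat A B = dsum_mat (c \<cdot>\<^sub>m A) (c \<cdot>\<^sub>m B)"
  unfolding dsum_mat_def by (intro eq_matI) auto

text \<open>The off-diagonal blocks are zero, so all cross terms vanish. Hence a state and an effect
  of different summands never meet in a product.\<close>

lemma dsum_mat_mult:
  fixes A B :: "'a::semiring_0 mat"
  assumes "A \<in> carrier_mat n m" "A' \<in> carrier_mat m l" "B \<in> carrier_mat n' m'" "B' \<in> carrier_mat m' l'"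
  shows "dsum_mat A B * dsum_mat A' B' = dsum_mat (A * A') (B * B')"
proof -
  have "dsum_mat A B * dsum_mat A' B' =
    four_block_mat (A * A' + 0\<^sub>m n m' * 0\<^sub>m m' l) (A * 0\<^sub>m m l' + 0\<^sub>m n m' * B')
      (0\<^sub>m n' m * A' + B * 0\<^sub>m m' l) (0\<^sub>m n' m * 0\<^sub>m m l' + B * B')"
    unfolding dsum_mat_def using assms
    by (subst mult_four_block_mat[of _ n m _ m' _ n' _ _ l _ l']) auto
  also have "\<dots> = dsum_mat (A * A') (B * B')"
    unfolding dsum_mat_def using assms by auto
  finally show ?thesis .
qed

lemma mat_trace_dsum_mat:
  assumes "A \<in> carrier_mat n n" "B \<in> carrier_mat m m"
  shows "mat_trace (dsum_mat A B) = mat_trace A + mat_trace B"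
proof -
  have "{..<n + m} = {..<n} \<union> {n..<n + m}" "{..<n} \<inter> {n..<n + m} = {}"
    by auto
  then have "(\<Sum>i<n + m. dsum_mat A B $$ (i, i)) =
      (\<Sum>i<n. dsum_mat A B $$ (i, i)) + (\<Sum>i\<in>{n..<n + m}. dsum_mat A B $$ (i, i))"
    by (simp add: sum.union_disjoint)
  \<comment> \<open>Shifting the index by \<open>n\<close> turns the remaining diagonal entries into
    those of the block \<open>B\<close>.\<close>
  also have "(\<Sum>i\<in>{n..<n + m}. dsum_mat A B $$ (i, i)) = (\<Sum>i<m. dsum_mat A B $$ (i + n, i + n))"
    using sum.shift_bounds_nat_ivl[of "\<lambda>i. dsum_mat A B $$ (i, i)" 0 n m]
    by (simp add: lessThan_atLeast0 add.commute)
  finally show ?thesis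
    using assms by (simp add: mat_trace_def dsum_mat_def)
qed

lemma mat_trace_smult: "A \<in> carrier_mat n n \<Longrightarrow> mat_trace (c \<cdot>\<^sub>m A) = c * mat_trace A"
  by (simp add: mat_trace_def sum_distrib_left)

lemma positive_op_carrier: "positive_op d A \<Longrightarrow> A \<in> carrier_mat d d"
  by (simp add: positive_op_def)

lemma positive_op_smult:
  assumes "positive_op d A" "0 \<le> c"
  shows "positive_op d (c \<cdot>\<^sub>m A)"
proof -
  have A: "A \<in> carrier_mat d d" using assms(1) by (rule positive_op_carrier)
  have "0 \<le> ((c \<cdot>\<^sub>m A) *\<^sub>v v) \<bullet>c v" if v: "v \<in> carrier_vec d" for v
  proof -
    have "(c \<cdot>\<^sub>m A) *\<^sub>v v = c \<cdot>\<^sub>v (A *\<^sub>v v)"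
      using A v by (intro eq_vecI) auto
    moreover have "(c \<cdot>\<^sub>v (A *\<^sub>v v)) \<bullet>c v = c * ((A *\<^sub>v v) \<bullet>c v)"
      using A v by (intro smult_scalar_prod_distrib[of _ d]) auto
    ultimately show ?thesis
      using assms v by (simp add: positive_op_def)
  qed
  then show ?thesis using A by (simp add: positive_op_def)
qed

lemma conjugate_append_vec:
  "conjugate (v @\<^sub>v w) = conjugate v @\<^sub>v conjugate (w :: 'a::conjugate vec)"
  by (intro eq_vecI) (auto simp: append_vec_def Let_def)

text \<open>Cutting a vector into its first \<open>n\<close> and last \<open>m\<close> coordinates
  splits the quadratic form into one nonnegative term for each block.\<close>

lemma positive_op_dsum_mat:
  assumes "positive_op n A" "positive_op m B"
  shows "positive_op (n + m) (dsum_mat A B)"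
proof -
  have A: "A \<in> carrier_mat n n" and B: "B \<in> carrier_mat m m"
    using assms by (auto dest: positive_op_carrier)
  have "0 \<le> (dsum_mat A B *\<^sub>v v) \<bullet>c v" if v: "v \<in> carrier_vec (n + m)" for v
  proof -
    define a where "a = vec_first v n"
    define b where "b = vec_last v m"
    have ab: "a \<in> carrier_vec n" "b \<in> carrier_vec m" "v = a @\<^sub>v b"
      using v by (auto simp: a_def b_def)
    have "dsum_mat A B *\<^sub>v v = (A *\<^sub>v a) @\<^sub>v (B *\<^sub>v b)"
      unfolding dsum_mat_def ab(3) using A B ab(1,2)
      by (subst four_block_mat_mult_vec[of _ n n _ m _ m]) auto
    then have "(dsum_mat A B *\<^sub>v v) \<bullet>c v = (A *\<^sub>v a) \<bullet>c a + (B *\<^sub>v b) \<bullet>c b"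
      unfolding ab(3) conjugate_append_vec using A B ab(1,2)
      by (simp, subst scalar_prod_append[of _ n _ m]) auto
    then show ?thesis
      using assms ab by (simp add: positive_op_def)
  qed
  then show ?thesis using A B by (auto simp: positive_op_def)
qed

text \<open>Both traces are 1, so the trace of the mixture is \<open>s + t\<close>; this is where
  the weights have to add up to 1.\<close>

lemma density_op_mixture:
  assumes "density_op n A" "density_op m B" "0 \<le> s" "0 \<le> t" "s + t = 1"
  shows "density_op (n + m) (dsum_mat (s \<cdot>\<^sub>m A) (t \<cdot>\<^sub>m B))"
proof -
  have "A \<in> carrier_mat n n" "B \<in> carrier_mat m m"
    using assms by (auto simp: density_op_def dest: positive_op_carrier)
  then have "mat_trace (dsum_mat (s \<cdot>\<^sub>m A) (t \<cdot>\<^sub>m B)) = s * mat_trace A + t * mat_trace B"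
    by (simp add: mat_trace_dsum_mat[of _ n _ m] mat_trace_smult)
  then show ?thesis
    using assms by (simp add: density_op_def positive_op_dsum_mat positive_op_smult)
qed

text \<open>Translates the abstract group sum into plain matrix addition, so that the later sums can
  be treated by induction on the index set.\<close>

lemma op_sum_insert:
  assumes "finite I" "i \<notin> I" "\<And>j. A j \<in> carrier_mat d d"
  shows "op_sum d A (insert i I) = A i + op_sum d A I"
proof -
  interpret abelian_group "module_mat TYPE(complex) d d"
    by (rule abelian_group_mat)
  show ?thesis
    using finsum_insert[OF assms(1,2), of A] assms(3) by (simp add: module_mat_simps)
qed

lemma op_sum_empty: "op_sum d A {} = 0\<^sub>m d d"
proof -
  interpret abelian_group "module_mat TYPE(complex) d d"
    by (rule abelian_group_mat)
  show ?thesis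
    by (simp add: module_mat_simps)
qed

lemma op_sum_carrier:
  assumes "\<And>i. A i \<in> carrier_mat d d"
  shows "op_sum d A I \<in> carrier_mat d d"
proof -
  interpret abelian_group "module_mat TYPE(complex) d d"
    by (rule abelian_group_mat)
  show ?thesis
    using finsum_closed[of A I] assms by (simp add: module_mat_simps)
qed

lemma op_sum_smult:
  assumes "finite I" "\<And>i. A i \<in> carrier_mat d d"
  shows "op_sum d (\<lambda>i. c \<cdot>\<^sub>m A i) I = c \<cdot>\<^sub>m op_sum d A I"
  using assms(1)
proof induction
  case (insert i I)
  then show ?case
    using assms(2) op_sum_carrier[of A d I] add_smult_distrib_left_mat[of "A i" d d _ c]
    by (simp add: op_sum_insert)
qed (simp add: op_sum_empty)

lemma op_sum_dsum_mat:
  assumes "finite I" "\<And>i. A i \<in> carrier_mat n n" "\<And>i. B i \<in> carrier_mat m m"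
  shows "op_sum (n + m) (\<lambda>i. dsum_mat (A i) (B i)) I = dsum_mat (op_sum n A I) (op_sum m B I)"
  using assms(1)
proof induction
  case (insert i I)
  then show ?case
    using assms(2,3)
    by (simp add: op_sum_insert dsum_mat_add[of _ n n _ _ m m] op_sum_carrier)
qed (simp add: op_sum_empty dsum_mat_zero)

text \<open>The weights \<open>s\<close> and \<open>t\<close> do not depend on the index and leave
  the sum. What remains in each block is the operator that a preparation equivalence of that summand
  constrains, with \<open>c\<close> as the distribution.\<close>

lemma op_sum_weighted_mixture:
  assumes "finite I" "\<And>i. A i \<in> carrier_mat n n" "\<And>i. B i \<in> carrier_mat m m"
  shows "op_sum (n + m) (\<lambda>i. c i \<cdot>\<^sub>m dsum_mat (s \<cdot>\<^sub>m A i) (t \<cdot>\<^sub>m B i)) I =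
    dsum_mat (s \<cdot>\<^sub>m op_sum n (\<lambda>i. c i \<cdot>\<^sub>m A i) I) (t \<cdot>\<^sub>m op_sum m (\<lambda>i. c i \<cdot>\<^sub>m B i) I)"
proof -
  have "a \<cdot>\<^sub>m (b \<cdot>\<^sub>m C) = b \<cdot>\<^sub>m (a \<cdot>\<^sub>m C)" for a b :: complex and C
    by (intro eq_matI) auto
  then have "(\<lambda>i. c i \<cdot>\<^sub>m dsum_mat (s \<cdot>\<^sub>m A i) (t \<cdot>\<^sub>m B i)) =
      (\<lambda>i. dsum_mat (s \<cdot>\<^sub>m (c i \<cdot>\<^sub>m A i)) (t \<cdot>\<^sub>m (c i \<cdot>\<^sub>m B i)))"
    by (simp add: dsum_mat_smult)
  then show ?thesis
    using assms by (simp add: op_sum_dsum_mat op_sum_smult)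
qed

text \<open>Since the effects carry no mixing weights, the sum over outcomes is the identity in each
  block, hence on the whole space.\<close>

lemma povm_dsum_mat:
  assumes "povm n M" "povm m N"
  shows "povm (n + m) (\<lambda>k. dsum_mat (M k) (N k))"
  using assms positive_op_carrier
  by (auto simp: povm_def positive_op_dsum_mat op_sum_dsum_mat dsum_mat_one)

theorem mainTheorem1:
  fixes T :: "('x::finite, 'y::finite, 'k::finite) scenario"
  assumes "contextuality_scenario T"
  shows "convex (quantum_behaviours T)"
proof (rule convexI)
  fix p q :: "real ^ ('k \<times> 'x \<times> 'y)" and s t :: real
  assume p: "p \<in> quantum_behaviours T" and q: "q \<in> quantum_behaviours T"
    and st: "0 \<le> s" "0 \<le> t" "s + t = 1"
  \<comment> \<open>The realisations of \<open>p\<close> and \<open>q\<close> may live in different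
    dimensions \<open>n\<close> and \<open>m\<close>.\<close>
  obtain n and \<rho> :: "'x \<Rightarrow> complex mat" and M :: "'y \<Rightarrow> 'k \<Rightarrow> complex mat" where
    1: "\<And>x. density_op n (\<rho> x)" "\<And>y. povm n (M y)"
      "\<And>k x y. complex_of_real (vec_nth p (k, x, y)) = mat_trace (\<rho> x * M y k)"
      "\<And>\<alpha> a a'. \<alpha> \<in> set (OE_P T) \<Longrightarrow> a \<in> set \<alpha> \<Longrightarrow> a' \<in> set \<alpha> \<Longrightarrow>
        op_sum n (\<lambda>x. complex_of_real (pmf a x) \<cdot>\<^sub>m \<rho> x) UNIV =
        op_sum n (\<lambda>x. complex_of_real (pmf a' x) \<cdot>\<^sub>m \<rho> x) UNIV"
      "\<And>\<beta> b b'. \<beta> \<in> set (OE_M T) \<Longrightarrow> b \<in> set \<beta> \<Longrightarrow> b' \<in> set \<beta> \<Longrightarrow>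
        op_sum n (\<lambda>(k, y). complex_of_real (pmf b (k, y)) \<cdot>\<^sub>m M y k) UNIV =
        op_sum n (\<lambda>(k, y). complex_of_real (pmf b' (k, y)) \<cdot>\<^sub>m M y k) UNIV"
    using p unfolding quantum_behaviours_def by blast
  obtain m and \<sigma> :: "'x \<Rightarrow> complex mat" and N :: "'y \<Rightarrow> 'k \<Rightarrow> complex mat" where
    2: "\<And>x. density_op m (\<sigma> x)" "\<And>y. povm m (N y)"
      "\<And>k x y. complex_of_real (vec_nth q (k, x, y)) = mat_trace (\<sigma> x * N y k)"
      "\<And>\<alpha> a a'. \<alpha> \<in> set (OE_P T) \<Longrightarrow> a \<in> set \<alpha> \<Longrightarrow> a' \<in> set \<alpha> \<Longrightarrow>
        op_sum m (\<lambda>x. complex_of_real (pmf a x) \<cdot>\<^sub>m \<sigma> x) UNIV =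
        op_sum m (\<lambda>x. complex_of_real (pmf a' x) \<cdot>\<^sub>m \<sigma> x) UNIV"
      "\<And>\<beta> b b'. \<beta> \<in> set (OE_M T) \<Longrightarrow> b \<in> set \<beta> \<Longrightarrow> b' \<in> set \<beta> \<Longrightarrow>
        op_sum m (\<lambda>(k, y). complex_of_real (pmf b (k, y)) \<cdot>\<^sub>m N y k) UNIV =
        op_sum m (\<lambda>(k, y). complex_of_real (pmf b' (k, y)) \<cdot>\<^sub>m N y k) UNIV"
    using q unfolding quantum_behaviours_def by blast
  have carr: "\<rho> x \<in> carrier_mat n n" "\<sigma> x \<in> carrier_mat m m"
    "M y k \<in> carrier_mat n n" "N y k \<in> carrier_mat m m" for x y k
    using 1(1,2) 2(1,2) by (auto simp: density_op_def povm_def intro: positive_op_carrier)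
  define \<tau> where
    "\<tau> x = dsum_mat (complex_of_real s \<cdot>\<^sub>m \<rho> x) (complex_of_real t \<cdot>\<^sub>m \<sigma> x)" for x
  define L where "L y k = dsum_mat (M y k) (N y k)" for y k
  have "density_op (n + m) (\<tau> x)" for x
    unfolding \<tau>_def using 1(1) 2(1) st
    by (intro density_op_mixture) (auto simp: less_eq_complex_def simp flip: of_real_add)
  moreover have "povm (n + m) (L y)" for y
    unfolding L_def using 1(2) 2(2) by (rule povm_dsum_mat)
  moreover have "complex_of_real (vec_nth (s *\<^sub>R p + t *\<^sub>R q) (k, x, y)) = mat_trace (\<tau> x * L y k)"
    for k x y
  proof -
    \<comment> \<open>The weights enter each block once, through the state only; the trace is
      therefore linear in \<open>s\<close> and \<open>t\<close>, as the Born rule for the mixture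
      demands.\<close>
    have "\<tau> x * L y k = dsum_mat (complex_of_real s \<cdot>\<^sub>m (\<rho> x * M y k)) (complex_of_real t \<cdot>\<^sub>m (\<sigma> x * N y k))"
      unfolding \<tau>_def L_def using carr
      by (simp add: dsum_mat_mult[of _ n n _ n _ m m _ m] mult_smult_assoc_mat[of _ n n _ n]
          mult_smult_assoc_mat[of _ m m _ m])
    moreover have "\<rho> x * M y k \<in> carrier_mat n n" "\<sigma> x * N y k \<in> carrier_mat m m"
      by (rule mult_carrier_mat[OF carr(1,3)] mult_carrier_mat[OF carr(2,4)])+
    ultimately show ?thesis
      by (simp add: mat_trace_dsum_mat[of _ n _ m] mat_trace_smult 1(3) 2(3))
  qed
  moreover have "op_sum (n + m) (\<lambda>x. complex_of_real (pmf a x) \<cdot>\<^sub>m \<tau> x) UNIV =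
      op_sum (n + m) (\<lambda>x. complex_of_real (pmf a' x) \<cdot>\<^sub>m \<tau> x) UNIV"
    if "\<alpha> \<in> set (OE_P T)" "a \<in> set \<alpha>" "a' \<in> set \<alpha>" for \<alpha> a a'
    \<comment> \<open>Both realisations obey the equivalences of the same \<open>T\<close>, so each
      block gives the same operator for \<open>a\<close> and \<open>a'\<close>.\<close>
    unfolding \<tau>_def using 1(4)[OF that] 2(4)[OF that] carr
    by (simp add: op_sum_weighted_mixture)
  moreover have "op_sum (n + m) (\<lambda>(k, y). complex_of_real (pmf b (k, y)) \<cdot>\<^sub>m L y k) UNIV =
      op_sum (n + m) (\<lambda>(k, y). complex_of_real (pmf b' (k, y)) \<cdot>\<^sub>m L y k) UNIV"
    if "\<beta> \<in> set (OE_M T)" "b \<in> set \<beta>" "b' \<in> set \<beta>" for \<beta> b b'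
    \<comment> \<open>The blocks agree here as well, now without weights;
      \<open>case_prod_unfold\<close> removes the pair pattern so that
      \<open>op_sum_dsum_mat\<close> applies to sums over pairs.\<close>
    unfolding L_def using 1(5)[OF that] 2(5)[OF that] carr
    by (simp add: case_prod_unfold dsum_mat_smult op_sum_dsum_mat)
  ultimately show "s *\<^sub>R p + t *\<^sub>R q \<in> quantum_behaviours T"
    unfolding quantum_behaviours_def mem_Collect_eq by (intro exI[of _ "n + m"] exI[of _ \<tau>] exI[of _ L]) blast
qed

end
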